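(* The class $\mathrm{Av}(1423, 1342)$ is the closure of $\mathrm{Av}(123)$ under LR-inflations; that is, $\mathrm{Av}(1423,1342)=\mathrm{Av}(123)^{\mathrm{LR}}$.
   Context: A permutation of length $n\ge 1$ is a sequence of all the $n$ distinct numbers of $[n]=\{1,\dots,n\}$. A permutation $\pi$ contains $\sigma$ if some subsequence of $\pi$ is order-isomorphic to $\sigma$ (has the same relative order); otherwise $\pi$ avoids $\sigma$. $\mathrm{Av}(\sigma,\rho,\dots)$ is the set of all permutations avoiding all of $\sigma,\rho,\dots$. A permutation class is a set of permutations closed under taking contained permutations. For a permutation $\pi$ of length $n$ and non-empty permutations $\sigma_1,\dots,\sigma_n$, the inflation $\pi[\sigma_1,\dots,\sigma_n]$ is the permutation that is a concatenation of blocks $\overline\sigma_1\cdots\overline\sigma_n$, where $\overline\sigma_i$ is order-isomorphic to $\sigma_i$, and whenever $\pi_i<\pi_j$ all elements of $\overline\sigma_i$ are smaller than all elements of $\overline\sigma_j$. An element $\pi_i$ is a left-to-right minimum (LR-minimum) of $\pi$ if it is smaller than all elements preceding it. If $\pi$ has $k$ LR-minima and $\sigma_1,\dots,\sigma_k$ are non-empty permutations, the LR-inflation $\pi\langle\sigma_1,\dots,\sigma_k\rangle$ is the permutation obtained by inflating the LR-minima of $\pi$ (taken from left to right) by $\sigma_1,\dots,\sigma_k$ and leaving every other element uninflated (i.e. inflated by the singleton permutation). A permutation class $C$ is closed under LR-inflations if for every $\pi\in C$ with $k$ LR-minima and all $\sigma_1,\dots,\sigma_k\in C$, we have $\pi\langle\sigma_1,\dots,\sigma_k\rangle\in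 C$. The closure of $C$ under LR-inflations, denoted $C^{\mathrm{LR}}$, is the smallest permutation class that contains $C$ and is closed under LR-inflations. *)

theory Defs
  imports Main "HOL-Library.Sublist"
begin

text \<open>
  Permutations are written in one-line notation, as lists over \<open>{1..n}\<close> with \<open>n \<ge> 1\<close>. The entries
  keep their values in \<open>{1..n}\<close>, but positions are list indices and therefore start at 0.
\<close>

definition is_perm :: "nat list \<Rightarrow> bool" where
  "is_perm p \<longleftrightarrow> p \<noteq> [] \<and> distinct p \<and> set p = {1..length p}"

definition order_iso :: "nat list \<Rightarrow> nat list \<Rightarrow> bool" where
  "order_iso xs ys \<longleftrightarrow> length xs = length ys \<and>
     (\<forall>i < length xs. \<forall>j < length xs. xs ! i < xs ! j \<longleftrightarrow> ys ! i < ys ! j)"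

definition contains :: "nat list \<Rightarrow> nat list \<Rightarrow> bool" where
  "contains p s \<longleftrightarrow> (\<exists>ys. subseq ys p \<and> order_iso ys s)"

definition Av :: "nat list set \<Rightarrow> nat list set" where
  "Av B = {p. is_perm p \<and> (\<forall>s \<in> B. \<not> contains p s)}"

definition perm_class :: "nat list set \<Rightarrow> bool" where
  "perm_class C \<longleftrightarrow> (\<forall>p \<in> C. is_perm p) \<and>
     (\<forall>p \<in> C. \<forall>s. is_perm s \<longrightarrow> contains p s \<longrightarrow> s \<in> C)"

text \<open>
  The block replacing \<open>p ! i\<close> is \<open>ss ! i\<close> shifted up by the total length of the blocks that must lie
  below it. The lemmas \<open>is_perm_inflate\<close> and \<open>inflate_blocks\<close> show that the result is the
  permutation described by the block conditions, and \<open>inflate_unique\<close> that these determine it.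
\<close>

definition block_offset :: "nat list \<Rightarrow> nat list list \<Rightarrow> nat \<Rightarrow> nat" where
  "block_offset p ss i = (\<Sum>j | j < length p \<and> p ! j < p ! i. length (ss ! j))"

definition blocks :: "nat list \<Rightarrow> nat list list \<Rightarrow> nat list list" where
  "blocks p ss = map (\<lambda>i. map (\<lambda>x. x + block_offset p ss i) (ss ! i)) [0..<length p]"

definition inflate :: "nat list \<Rightarrow> nat list list \<Rightarrow> nat list" where
  "inflate p ss = concat (blocks p ss)"

definition LR_min :: "nat list \<Rightarrow> nat \<Rightarrow> bool" where
  "LR_min p i \<longleftrightarrow> i < length p \<and> (\<forall>j < i. p ! i < p ! j)"

definition num_LR_min :: "nat list \<Rightarrow> nat" where
  "num_LR_min p = card {i. LR_min p i}"

text \<open>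
  The LR-minimum at position \<open>i\<close> is inflated by the entry of \<open>ss\<close> whose index is the number of
  LR-minima to the left of \<open>i\<close>.
\<close>

definition LR_inflate :: "nat list \<Rightarrow> nat list list \<Rightarrow> nat list" where
  "LR_inflate p ss = inflate p
     (map (\<lambda>i. if LR_min p i then ss ! card {j. j < i \<and> LR_min p j} else [1]) [0..<length p])"

definition LR_closed :: "nat list set \<Rightarrow> bool" where
  "LR_closed C \<longleftrightarrow>
     (\<forall>p \<in> C. \<forall>ss. length ss = num_LR_min p \<longrightarrow> set ss \<subseteq> C \<longrightarrow> LR_inflate p ss \<in> C)"

text \<open>
  The intersection is itself an LR-closed class whenever \<open>C\<close> consists of permutations, see
  \<open>LR_closure_least\<close>.
\<close>

definition LR_closure :: "nat list set \<Rightarrow> nat list set" where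
  "LR_closure C = \<Inter> {D. perm_class D \<and> C \<subseteq> D \<and> LR_closed D}"


lemma length_blocks [simp]: "length (blocks p ss) = length p"
  by (simp add: blocks_def)

lemma nth_blocks:
  "i < length p \<Longrightarrow> blocks p ss ! i = map (\<lambda>x. x + block_offset p ss i) (ss ! i)"
  by (simp add: blocks_def)

lemma block_offset_less:
  assumes "i < length p" "p ! i < p ! j"
  shows "block_offset p ss i + length (ss ! i) \<le> block_offset p ss j"
proof -
  have "block_offset p ss i + length (ss ! i)
      = (\<Sum>k \<in> insert i {k. k < length p \<and> p ! k < p ! i}. length (ss ! k))"
    by (simp add: block_offset_def)
  also have "\<dots> \<le> block_offset p ss j"
    unfolding block_offset_def using assms by (intro sum_mono2) auto
  finally show ?thesis .
qed

lemma block_offset_le: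
  assumes "i < length p"
  shows "block_offset p ss i + length (ss ! i) \<le> (\<Sum>k<length p. length (ss ! k))"
proof -
  have "block_offset p ss i + length (ss ! i)
      = (\<Sum>k \<in> insert i {k. k < length p \<and> p ! k < p ! i}. length (ss ! k))"
    by (simp add: block_offset_def)
  also have "\<dots> \<le> (\<Sum>k<length p. length (ss ! k))"
    using assms by (intro sum_mono2) auto
  finally show ?thesis .
qed

lemma length_inflate: "length (inflate p ss) = (\<Sum>k<length p. length (ss ! k))"
proof -
  have "length (inflate p ss) = sum_list (map (\<lambda>k. length (ss ! k)) [0..<length p])"
    by (simp add: inflate_def blocks_def length_concat comp_def)
  also have "\<dots> = (\<Sum>k<length p. length (ss ! k))"
    by (simp add: interv_sum_list_conv_sum_set_nat atLeast0LessThan)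
  finally show ?thesis .
qed

lemma inflate_blocks:
  assumes "is_perm p" "length ss = length p" "\<forall>s \<in> set ss. is_perm s"
  shows "\<forall>i < length p. order_iso (blocks p ss ! i) (ss ! i)"
    and "\<forall>i < length p. \<forall>j < length p. p ! i < p ! j \<longrightarrow>
           (\<forall>x \<in> set (blocks p ss ! i). \<forall>y \<in> set (blocks p ss ! j). x < y)"
proof -
  show "\<forall>i < length p. order_iso (blocks p ss ! i) (ss ! i)"
    by (simp add: nth_blocks order_iso_def)
  show "\<forall>i < length p. \<forall>j < length p. p ! i < p ! j \<longrightarrow>
           (\<forall>x \<in> set (blocks p ss ! i). \<forall>y \<in> set (blocks p ss ! j). x < y)"
  proof (intro allI impI ballI)
    fix i j x y
    assume a: "i < length p" "j < length p" "p ! i < p ! j"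
      "x \<in> set (blocks p ss ! i)" "y \<in> set (blocks p ss ! j)"
    have s: "is_perm (ss ! i)" "is_perm (ss ! j)" using a assms by auto
    have "x \<le> block_offset p ss i + length (ss ! i)" "block_offset p ss j < y"
      using a s by (auto simp: nth_blocks is_perm_def)
    then show "x < y" using block_offset_less[OF a(1,3), of ss] by linarith
  qed
qed

lemma is_perm_inflate:
  assumes "is_perm p" "length ss = length p" "\<forall>s \<in> set ss. is_perm s"
  shows "is_perm (inflate p ss)"
proof -
  let ?N = "\<Sum>k<length p. length (ss ! k)"
  have s: "is_perm (ss ! i)" if "i < length p" for i using that assms by auto
  have disj: "set (blocks p ss ! i) \<inter> set (blocks p ss ! j) = {}"
    if "i < length p" "j < length p" "i \<noteq> j" for i j
  proof -
    have "p ! i \<noteq> p ! j" using that assms(1) by (simp add: is_perm_def nth_eq_iff_index_eq)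
    then consider "p ! i < p ! j" | "p ! j < p ! i" by linarith
    then show ?thesis
      using inflate_blocks(2)[OF assms] that by cases (metis disjoint_iff less_irrefl)+
  qed
  have ne: "blocks p ss ! i \<noteq> []" if "i < length p" for i
    using s[OF that] that by (simp add: nth_blocks is_perm_def)
  have dB: "distinct (blocks p ss)"
    unfolding distinct_conv_nth using disj ne by (metis Int_absorb length_blocks set_empty)
  have dist: "distinct (inflate p ss)"
    unfolding inflate_def
  proof (rule distinct_concat[OF dB])
    fix ys assume "ys \<in> set (blocks p ss)"
    then show "distinct ys"
      using s by (auto simp: in_set_conv_nth nth_blocks is_perm_def distinct_map)
  next
    fix ys zs assume "ys \<in> set (blocks p ss)" "zs \<in> set (blocks p ss)" "ys \<noteq> zs"
    then show "set ys \<inter> set zs = {}" using disj by (metis in_set_conv_nth length_blocks)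
  qed
  have sub: "set (inflate p ss) \<subseteq> {1..?N}"
  proof
    fix x assume "x \<in> set (inflate p ss)"
    then obtain i where i: "i < length p" "x \<in> set (blocks p ss ! i)"
      by (auto simp: inflate_def in_set_conv_nth) (metis in_set_conv_nth length_blocks)
    then have "1 \<le> x" "x \<le> block_offset p ss i + length (ss ! i)"
      using s[OF i(1)] by (auto simp: nth_blocks is_perm_def)
    then show "x \<in> {1..?N}" using block_offset_le[OF i(1), of ss] by simp
  qed
  have "set (inflate p ss) = {1..?N}"
    using sub by (rule card_subset_eq[rotated])
      (simp_all add: distinct_card[OF dist] length_inflate)
  moreover have "inflate p ss \<noteq> []"
  proof -
    have "0 < length p" using assms(1) by (simp add: is_perm_def)
    then show ?thesis using ne[of 0] by (auto simp: inflate_def)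
  qed
  ultimately show ?thesis using dist by (simp add: is_perm_def length_inflate)
qed

lemma perm_nth_eq_card:
  assumes "is_perm q" "i < length q"
  shows "q ! i = card {j. j < length q \<and> q ! j < q ! i} + 1"
proof -
  have "(!) q ` {j. j < length q \<and> q ! j < q ! i} = {1..<q ! i}"
  proof
    show "{1..<q ! i} \<subseteq> (!) q ` {j. j < length q \<and> q ! j < q ! i}"
    proof
      fix v assume v: "v \<in> {1..<q ! i}"
      have "q ! i \<in> {1..length q}" using assms nth_mem is_perm_def by metis
      then have "v \<in> set q" using v assms(1) by (simp add: is_perm_def)
      then show "v \<in> (!) q ` {j. j < length q \<and> q ! j < q ! i}"
        using v by (auto simp: in_set_conv_nth)
    qed
  next
    have "1 \<le> q ! j" if "j < length q" for j
      using that assms(1) nth_mem[OF that] by (simp add: is_perm_def)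
    then show "(!) q ` {j. j < length q \<and> q ! j < q ! i} \<subseteq> {1..<q ! i}" by auto
  qed
  moreover have "inj_on ((!) q) {j. j < length q \<and> q ! j < q ! i}"
    using assms(1) by (auto simp: inj_on_def is_perm_def nth_eq_iff_index_eq)
  ultimately have "card {j. j < length q \<and> q ! j < q ! i} = q ! i - 1"
    by (metis card_image card_atLeastLessThan)
  moreover have "1 \<le> q ! i" using assms nth_mem[OF assms(2)] by (simp add: is_perm_def)
  ultimately show ?thesis by simp
qed

lemma order_iso_perm_eq:
  assumes "is_perm q" "is_perm r" "order_iso q r"
  shows "q = r"
proof (rule nth_equalityI)
  show len: "length q = length r" using assms(3) by (simp add: order_iso_def)
  fix i assume i: "i < length q"
  have "{j. j < length q \<and> q ! j < q ! i} = {j. j < length r \<and> r ! j < r ! i}"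
    using assms(3) i by (auto simp: order_iso_def)
  then show "q ! i = r ! i"
    using perm_nth_eq_card[OF assms(1) i] perm_nth_eq_card[OF assms(2)] i len by simp
qed

lemma concat_nth_same_shape:
  fixes bs :: "'a list list"
  assumes "i < length (concat bs)"
  obtains a b where "a < length bs" "b < length (bs ! a)"
    "\<And>cs :: 'a list list. map length cs = map length bs \<Longrightarrow> concat cs ! i = cs ! a ! b"
proof -
  have "\<exists>a b. a < length bs \<and> b < length (bs ! a) \<and>
      (\<forall>cs :: 'a list list. map length cs = map length bs \<longrightarrow> concat cs ! i = cs ! a ! b)"
    using assms
  proof (induction bs arbitrary: i)
    case (Cons x xs)
    show ?case
    proof (cases "i < length x")
      case True
      then show ?thesis
        by (intro exI[of _ 0] exI[of _ i]) (auto simp: map_eq_Cons_conv nth_append)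
    next
      case False
      then have "i - length x < length (concat xs)" using Cons.prems by simp
      from Cons.IH[OF this] obtain a b where "a < length xs" "b < length (xs ! a)"
        "\<forall>cs :: 'a list list. map length cs = map length xs \<longrightarrow> concat cs ! (i - length x) = cs ! a ! b" by blast
      then show ?thesis using False
        by (intro exI[of _ "Suc a"] exI[of _ b]) (auto simp: map_eq_Cons_conv nth_append)
    qed
  qed simp
  then show ?thesis using that by blast
qed

lemma inflate_unique:
  assumes "is_perm p" "length ss = length p" "\<forall>s \<in> set ss. is_perm s"
    and "is_perm (concat bs)" "length bs = length p"
    and iso: "\<forall>i < length p. order_iso (bs ! i) (ss ! i)"
    and less: "\<forall>i < length p. \<forall>j < length p. p ! i < p ! j \<longrightarrow>
      (\<forall>x \<in> set (bs ! i). \<forall>y \<in> set (bs ! j). x < y)"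
  shows "concat bs = inflate p ss"
proof (rule order_iso_perm_eq[OF assms(4) is_perm_inflate[OF assms(1-3)]])
  let ?cs = "blocks p ss"
  note iso' = inflate_blocks(1)[OF assms(1-3)] and less' = inflate_blocks(2)[OF assms(1-3)]
  have shape: "map length ?cs = map length bs"
    using iso iso' assms(5) by (intro nth_equalityI) (auto simp: order_iso_def)
  show "order_iso (concat bs) (inflate p ss)"
    unfolding order_iso_def
  proof (intro conjI allI impI)
    show "length (concat bs) = length (inflate p ss)"
      by (simp add: inflate_def length_concat shape)
    fix i j assume "i < length (concat bs)" "j < length (concat bs)"
    then obtain a b c d where ab: "a < length bs" "b < length (bs ! a)"
        "\<And>cs :: nat list list. map length cs = map length bs \<Longrightarrow> concat cs ! i = cs ! a ! b"
      and cd: "c < length bs" "d < length (bs ! c)"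
        "\<And>cs :: nat list list. map length cs = map length bs \<Longrightarrow> concat cs ! j = cs ! c ! d"
      by (metis concat_nth_same_shape)
    have len: "length (?cs ! a) = length (bs ! a)" "length (?cs ! c) = length (bs ! c)"
      using ab(1) cd(1) assms(5) shape by (metis length_blocks nth_map)+
    have m: "bs ! a ! b \<in> set (bs ! a)" "bs ! c ! d \<in> set (bs ! c)"
      "?cs ! a ! b \<in> set (?cs ! a)" "?cs ! c ! d \<in> set (?cs ! c)"
      using ab cd len by auto
    have "bs ! a ! b < bs ! c ! d \<longleftrightarrow> ?cs ! a ! b < ?cs ! c ! d"
    proof (cases "a = c")
      case True
      then show ?thesis using iso iso' ab cd assms(5) len by (auto simp: order_iso_def)
    next
      case False
      then have "p ! a \<noteq> p ! c"
        using assms(1,5) ab cd by (simp add: is_perm_def nth_eq_iff_index_eq)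
      then consider "p ! a < p ! c" | "p ! c < p ! a" by linarith
      then show ?thesis
        using less less' m ab(1) cd(1) assms(5) by cases (metis less_asym)+
    qed
    then show "concat bs ! i < concat bs ! j \<longleftrightarrow> inflate p ss ! i < inflate p ss ! j"
      using ab(3)[of bs] ab(3)[OF shape] cd(3)[of bs] cd(3)[OF shape] by (simp add: inflate_def)
  qed
qed

lemma LR_closure_least:
  assumes "\<forall>p \<in> C. is_perm p"
  shows "perm_class (LR_closure C)" "C \<subseteq> LR_closure C" "LR_closed (LR_closure C)"
    and "\<And>D. perm_class D \<Longrightarrow> C \<subseteq> D \<Longrightarrow> LR_closed D \<Longrightarrow> LR_closure C \<subseteq> D"
proof -
  have card_lt: "card {j. j < i \<and> LR_min p j} < num_LR_min p" if "LR_min p i" for p i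
    unfolding num_LR_min_def
  proof (rule psubset_card_mono)
    show "finite {i. LR_min p i}" by (simp add: LR_min_def)
    show "{j. j < i \<and> LR_min p j} \<subset> {i. LR_min p i}" using that by auto
  qed
  have "is_perm (LR_inflate p ss)"
    if "is_perm p" "length ss = num_LR_min p" "\<forall>s \<in> set ss. is_perm s" for p ss
    unfolding LR_inflate_def
  proof (rule is_perm_inflate[OF that(1)])
    show "\<forall>s \<in> set (map (\<lambda>i. if LR_min p i then ss ! card {j. j < i \<and> LR_min p j} else [1])
        [0..<length p]). is_perm s"
      using that card_lt by (auto simp: is_perm_def[of "[Suc 0]"])
  qed simp
  then have all: "perm_class {p. is_perm p} \<and> C \<subseteq> {p. is_perm p} \<and> LR_closed {p. is_perm p}"
    using assms by (auto simp: perm_class_def LR_closed_def subset_iff)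
  then show "perm_class (LR_closure C)"
    unfolding perm_class_def LR_closure_def by blast
  show "C \<subseteq> LR_closure C" by (auto simp: LR_closure_def)
  show "LR_closed (LR_closure C)"
    unfolding LR_closed_def LR_closure_def by blast
  show "\<And>D. perm_class D \<Longrightarrow> C \<subseteq> D \<Longrightarrow> LR_closed D \<Longrightarrow> LR_closure C \<subseteq> D"
    unfolding LR_closure_def by blast
qed

end

theory Submission
  imports Defs
begin

text \<open>
  In 1423 and in 1342, an interval (a set of entries consecutive both in position and in value)
  with more than one entry is either everything or misses the initial 1. This is why the class is
  closed under LR-inflations: a forbidden pattern in an LR-inflation meets each block in an
  interval of the pattern. If it lies in one block, the inserted permutation contains it; if
  its four entries lie in four blocks, the inflated permutation contains it. Otherwise some block
  contains at least two entries of the pattern but not its 1. Such a block replaces an LR-minimum,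
  whereas the 1 lies to the left of the block and below it (\<open>LR_closed_Av\<close>).

  Conversely, a permutation in the class either avoids 123 or is an LR-inflation of a strictly
  shorter member of the class by strictly shorter members, so induction on the length applies. For
  this one needs a proper interval with at least two entries that contains an LR-minimum
  (\<open>obtain_interval\<close>), because contracting it to a point leaves an LR-minimum
  (\<open>LR_inflate_contraction\<close>). Take an occurrence \<open>a < b < c\<close> of 123 whose first entry is an
  LR-minimum, and join two entries lying below and to the left of \<open>c\<close> by an edge if they form an
  increasing pair. The connected component of \<open>a\<close> contains \<open>b\<close> but not \<open>c\<close>, and it is an
  interval: if an entry \<open>e\<close> separates the component in position, then some edge \<open>u < v\<close> of the
  component jumps over \<open>e\<close>; if \<open>e > c\<close> then \<open>u e v c\<close> is an occurrence of 1423, and otherwise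
  \<open>e\<close> is itself joined to \<open>u\<close> or \<open>v\<close>. Separation in value is treated in the same way with
  positions and values exchanged, and yields 1342 instead (\<open>component_interval\<close>).
\<close>

section \<open>Containment in terms of positions\<close>

lemma contains_iff_indices:
  "contains p s \<longleftrightarrow>
     (\<exists>js. sorted_wrt (<) js \<and> set js \<subseteq> {..<length p} \<and> order_iso (map ((!) p) js) s)"
proof
  assume "contains p s"
  then obtain N where N: "order_iso (nths p N) s"
    by (auto simp: contains_def subseq_conv_nths)
  have "nths p N = map ((!) p) (nths [0..<length p] N)"
    by (metis map_nth nths_map)
  moreover have "sorted_wrt (<) (nths [0..<length p] N)"
    by (simp add: strict_sorted_iff sorted_nths)
  moreover have "set (nths [0..<length p] N) \<subseteq> {..<length p}"
    using set_nths_subset[of "[0..<length p]" N] by auto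
  ultimately show "\<exists>js. sorted_wrt (<) js \<and> set js \<subseteq> {..<length p} \<and>
      order_iso (map ((!) p) js) s"
    using N by metis
next
  assume "\<exists>js. sorted_wrt (<) js \<and> set js \<subseteq> {..<length p} \<and> order_iso (map ((!) p) js) s"
  then obtain js where js: "sorted_wrt (<) js" "set js \<subseteq> {..<length p}"
    "order_iso (map ((!) p) js) s" by blast
  have "subseq js [0..<length p]"
    using js(1,2) by (intro sorted_subset_imp_subseq) (auto simp: atLeast0LessThan)
  then have "subseq (map ((!) p) js) p"
    using subseq_map[of js "[0..<length p]" "(!) p"] by (simp add: map_nth)
  with js(3) show "contains p s" by (auto simp: contains_def)
qed

lemma contains_trans:
  assumes "contains p q" "contains q r"
  shows "contains p r"
proof -
  obtain js where js: "sorted_wrt (<) js" "set js \<subseteq> {..<length p}"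
    "order_iso (map ((!) p) js) q"
    using assms(1) contains_iff_indices by blast
  obtain ks where ks: "sorted_wrt (<) ks" "set ks \<subseteq> {..<length q}"
    "order_iso (map ((!) q) ks) r"
    using assms(2) contains_iff_indices by blast
  have len: "length js = length q" using js(3) by (simp add: order_iso_def)
  have k: "ks ! i < length q" if "i < length ks" for i using ks(2) that nth_mem by blast
  let ?ls = "map ((!) js) ks"
  have "sorted_wrt (<) ?ls"
    using js(1) ks(1) k len by (simp add: sorted_wrt_iff_nth_less)
  moreover have "set ?ls \<subseteq> {..<length p}" using js(2) ks(2) len by force
  moreover have "order_iso (map ((!) p) ?ls) r"
    using js(3) ks(3) k len by (auto simp: order_iso_def)
  ultimately show ?thesis using contains_iff_indices by blast
qed

lemma perm_class_Av: "perm_class (Av B)"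
  unfolding perm_class_def Av_def using contains_trans by blast

lemma contains_123_iff:
  "contains p [1,2,3] \<longleftrightarrow> (\<exists>i j k. i < j \<and> j < k \<and> k < length p \<and> p ! i < p ! j \<and> p ! j < p ! k)"
proof
  assume "contains p [1,2,3]"
  then obtain js where js: "sorted_wrt (<) js" "set js \<subseteq> {..<length p}"
    "order_iso (map ((!) p) js) [1,2,3]"
    using contains_iff_indices by blast
  then have "length js = 3" by (simp add: order_iso_def)
  then obtain i j k where "js = [i,j,k]"
    by (auto simp: numeral_eq_Suc length_Suc_conv)
  with js show "\<exists>i j k. i < j \<and> j < k \<and> k < length p \<and> p ! i < p ! j \<and> p ! j < p ! k"
    by (intro exI[of _ i] exI[of _ j] exI[of _ k]) (simp add: order_iso_def All_less_Suc2)
next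
  assume "\<exists>i j k. i < j \<and> j < k \<and> k < length p \<and> p ! i < p ! j \<and> p ! j < p ! k"
  then obtain i j k where "i < j" "j < k" "k < length p" "p ! i < p ! j" "p ! j < p ! k" by blast
  then show "contains p [1,2,3]"
    unfolding contains_iff_indices
    by (intro exI[of _ "[i,j,k]"]) (simp add: order_iso_def All_less_Suc2)
qed

text \<open>
  The first alternative is an occurrence of 1423, the second one of 1342. They are kept in one
  predicate because a single case analysis serves both.
\<close>

definition bad_quadruple :: "nat list \<Rightarrow> nat \<Rightarrow> nat \<Rightarrow> nat \<Rightarrow> nat \<Rightarrow> bool" where
  "bad_quadruple p i j k l \<longleftrightarrow> i < j \<and> j < k \<and> k < l \<and> l < length p \<and>
     (p ! i < p ! k \<and> p ! k < p ! l \<and> p ! l < p ! j \<or>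
      p ! i < p ! l \<and> p ! l < p ! j \<and> p ! j < p ! k)"

lemma contains_1423_or_1342_iff:
  "contains p [1,4,2,3] \<or> contains p [1,3,4,2] \<longleftrightarrow> (\<exists>i j k l. bad_quadruple p i j k l)"
proof
  assume "contains p [1,4,2,3] \<or> contains p [1,3,4,2]"
  then obtain s js where js: "s = [1,4,2,3] \<or> s = [1,3,4,2]"
    "sorted_wrt (<) js" "set js \<subseteq> {..<length p}" "order_iso (map ((!) p) js) s"
    using contains_iff_indices by blast
  then have "length js = 4" by (auto simp: order_iso_def)
  then obtain i j k l where ijkl: "js = [i,j,k,l]"
    by (auto simp: numeral_eq_Suc length_Suc_conv)
  have iso: "p ! (js ! a) < p ! (js ! b) \<longleftrightarrow> s ! a < s ! b" if "a < 4" "b < 4" for a b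
    using js(4) that \<open>length js = 4\<close> by (simp add: order_iso_def)
  have "sorted_wrt (<) [i,j,k,l]" "l < length p" using js(2,3) ijkl by auto
  moreover have "p ! i < p ! k" "p ! i < p ! l" "p ! k < p ! l \<longleftrightarrow> s ! 2 < s ! 3"
      "p ! l < p ! j" "p ! j < p ! k \<longleftrightarrow> s ! 1 < s ! 2"
    using iso[of 0 2] iso[of 0 3] iso[of 2 3] iso[of 3 1] iso[of 1 2] js(1) ijkl by auto
  ultimately show "\<exists>i j k l. bad_quadruple p i j k l"
    using js(1) by (intro exI[of _ i] exI[of _ j] exI[of _ k] exI[of _ l])
      (auto simp: bad_quadruple_def)
next
  assume "\<exists>i j k l. bad_quadruple p i j k l"
  then obtain i j k l where b: "bad_quadruple p i j k l" by blast
  have "sorted_wrt (<) [i,j,k,l]" "set [i,j,k,l] \<subseteq> {..<length p}"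
    using b by (auto simp: bad_quadruple_def)
  moreover consider "p ! i < p ! k" "p ! k < p ! l" "p ! l < p ! j"
    | "p ! i < p ! l" "p ! l < p ! j" "p ! j < p ! k"
    using b by (auto simp: bad_quadruple_def)
  then have "order_iso (map ((!) p) [i,j,k,l]) [1,4,2,3] \<or>
      order_iso (map ((!) p) [i,j,k,l]) [1,3,4,2]"
    by cases (simp_all add: order_iso_def All_less_Suc2)
  ultimately show "contains p [1,4,2,3] \<or> contains p [1,3,4,2]"
    using contains_iff_indices by meson
qed

lemma Av_1423_1342_iff:
  "p \<in> Av {[1,4,2,3], [1,3,4,2]} \<longleftrightarrow> is_perm p \<and> (\<forall>i j k l. \<not> bad_quadruple p i j k l)"
  using contains_1423_or_1342_iff[of p] by (auto simp: Av_def)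

lemma singleton_in_Av_123: "[1] \<in> Av {[1,2,3]}"
proof -
  have "\<not> contains [1] [1,2,3]" unfolding contains_123_iff by auto
  then show ?thesis by (simp add: Av_def is_perm_def)
qed

lemma Av_123_subset: "Av {[1,2,3]} \<subseteq> Av {[1,4,2,3], [1,3,4,2]}"
proof -
  have "contains [1,4,2,3] [1,2,3]" "contains [1,3,4,2] [1,2,3]"
    unfolding contains_iff_indices
    by (rule exI[of _ "[0,2,3]"], simp add: order_iso_def All_less_Suc2)
      (rule exI[of _ "[0,1,2]"], simp add: order_iso_def All_less_Suc2)
  then show ?thesis unfolding Av_def using contains_trans by blast
qed

section \<open>The avoidance class is closed under LR-inflations\<close>

text \<open>
  Every position of a concatenation is addressed by a block number \<open>A\<close> and a position \<open>B\<close> within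
  that block; the second property says that the order of positions is lexicographic in the
  addresses. It reduces questions about patterns in inflations to comparisons of addresses.
\<close>

lemma concat_block_coordinates:
  fixes bs :: "'a list list"
  obtains A B where
    "\<And>i. i < length (concat bs) \<Longrightarrow>
      A i < length bs \<and> B i < length (bs ! A i) \<and> concat bs ! i = bs ! A i ! B i"
    "\<And>i j. i < j \<Longrightarrow> j < length (concat bs) \<Longrightarrow> A i < A j \<or> A i = A j \<and> B i < B j"
proof -
  have "\<exists>A B. (\<forall>i < length (concat bs). A i < length bs \<and> B i < length (bs ! A i) \<and>
        concat bs ! i = bs ! A i ! B i) \<and>
      (\<forall>i j. i < j \<and> j < length (concat bs) \<longrightarrow> A i < A j \<or> A i = A j \<and> B i < B j)"
  proof (induction bs)
    case (Cons x xs)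
    then obtain A B where AB:
      "\<And>i. i < length (concat xs) \<Longrightarrow> A i < length xs \<and> B i < length (xs ! A i) \<and>
        concat xs ! i = xs ! A i ! B i"
      "\<And>i j. i < j \<and> j < length (concat xs) \<Longrightarrow> A i < A j \<or> A i = A j \<and> B i < B j"
      by blast
    let ?A = "\<lambda>i. if i < length x then 0 else Suc (A (i - length x))"
    let ?B = "\<lambda>i. if i < length x then i else B (i - length x)"
    have coords: "?A i < length (x # xs) \<and> ?B i < length ((x # xs) ! ?A i) \<and>
        concat (x # xs) ! i = (x # xs) ! ?A i ! ?B i" if "i < length (concat (x # xs))" for i
      using AB(1)[of "i - length x"] that by (auto simp: nth_append)
    have mono: "?A i < ?A j \<or> ?A i = ?A j \<and> ?B i < ?B j"
      if "i < j" "j < length (concat (x # xs))" for i j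
    proof (cases "i < length x")
      case False
      then have "i - length x < j - length x" "j - length x < length (concat xs)"
        using that by auto
      then show ?thesis using AB(2) False that(1) by auto
    qed (use that in auto)
    show ?case by (rule exI[of _ ?A], rule exI[of _ ?B]) (use coords mono in blast)
  qed simp
  then obtain A B where AB:
    "\<And>i. i < length (concat bs) \<Longrightarrow>
      A i < length bs \<and> B i < length (bs ! A i) \<and> concat bs ! i = bs ! A i ! B i"
    "\<And>i j. i < j \<Longrightarrow> j < length (concat bs) \<Longrightarrow> A i < A j \<or> A i = A j \<and> B i < B j"
    by blast
  show thesis by (rule that[of A B]) (fact AB)+
qed

lemma inflate_coordinates:
  assumes "is_perm p" "length ss = length p" "\<forall>s \<in> set ss. is_perm s"
  obtains A B where
    "\<And>i. i < length (inflate p ss) \<Longrightarrow> A i < length p \<and> B i < length (ss ! A i)"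
    "\<And>i j. i < j \<Longrightarrow> j < length (inflate p ss) \<Longrightarrow> A i < A j \<or> A i = A j \<and> B i < B j"
    "\<And>i j. i < length (inflate p ss) \<Longrightarrow> j < length (inflate p ss) \<Longrightarrow> A i \<noteq> A j \<Longrightarrow>
       inflate p ss ! i < inflate p ss ! j \<longleftrightarrow> p ! A i < p ! A j"
    "\<And>i j. i < length (inflate p ss) \<Longrightarrow> j < length (inflate p ss) \<Longrightarrow> A i = A j \<Longrightarrow>
       inflate p ss ! i < inflate p ss ! j \<longleftrightarrow> ss ! A i ! B i < ss ! A j ! B j"
proof -
  let ?w = "inflate p ss"
  obtain A B where AB:
    "\<And>i. i < length ?w \<Longrightarrow> A i < length p \<and> B i < length (blocks p ss ! A i) \<and>
        ?w ! i = blocks p ss ! A i ! B i"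
    "\<And>i j. i < j \<Longrightarrow> j < length ?w \<Longrightarrow> A i < A j \<or> A i = A j \<and> B i < B j"
    by (rule concat_block_coordinates[of "blocks p ss", folded inflate_def, unfolded length_blocks])
      blast
  have len: "length (blocks p ss ! a) = length (ss ! a)" if "a < length p" for a
    using that by (simp add: nth_blocks)
  have val: "?w ! i = ss ! A i ! B i + block_offset p ss (A i)" if "i < length ?w" for i
  proof -
    have "A i < length p" "B i < length (ss ! A i)" "?w ! i = blocks p ss ! A i ! B i"
      using AB(1)[OF that] len[of "A i"] by simp_all
    then show ?thesis by (simp add: nth_blocks)
  qed
  have less: "?w ! i < ?w ! j"
    if "i < length ?w" "j < length ?w" "p ! A i < p ! A j" for i j
    using inflate_blocks(2)[OF assms] AB(1)[OF that(1)] AB(1)[OF that(2)] that(3)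
    by (metis nth_mem)
  show ?thesis
  proof (rule that[of A B])
    show "A i < length p \<and> B i < length (ss ! A i)" if "i < length ?w" for i
      using AB(1)[OF that] len[of "A i"] by simp
    show "A i < A j \<or> A i = A j \<and> B i < B j" if "i < j" "j < length ?w" for i j
      using AB(2) that by blast
    show "?w ! i < ?w ! j \<longleftrightarrow> p ! A i < p ! A j"
      if "i < length ?w" "j < length ?w" "A i \<noteq> A j" for i j
    proof -
      have "p ! A i \<noteq> p ! A j"
        using that AB(1) assms(1) by (simp add: is_perm_def nth_eq_iff_index_eq)
      then show ?thesis using less that by (metis less_asym linorder_neqE_nat)
    qed
    show "?w ! i < ?w ! j \<longleftrightarrow> ss ! A i ! B i < ss ! A j ! B j"
      if "i < length ?w" "j < length ?w" "A i = A j" for i j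
      using val[OF that(1)] val[OF that(2)] that(3) by simp
  qed
qed

lemma card_LR_min_before_less:
  assumes "LR_min p i"
  shows "card {j. j < i \<and> LR_min p j} < num_LR_min p"
  unfolding num_LR_min_def
proof (rule psubset_card_mono)
  show "finite {i. LR_min p i}" by (simp add: LR_min_def)
  show "{j. j < i \<and> LR_min p j} \<subset> {i. LR_min p i}" using assms by auto
qed

text \<open>
  The key facts below are \<open>first\<close>, which says that a block with two entries of the pattern must
  contain its smallest entry, and \<open>between\<close>, which says that blocks are intervals in value.
\<close>

lemma LR_closed_Av: "LR_closed (Av {[1,4,2,3], [1,3,4,2]})"
  unfolding LR_closed_def
proof (intro ballI allI impI)
  let ?C = "Av {[1,4,2,3], [1,3,4,2]}"
  fix p ts assume p: "p \<in> ?C" and ts: "length ts = num_LR_min p" "set ts \<subseteq> ?C"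
  define ss where "ss = map (\<lambda>i. if LR_min p i then ts ! card {j. j < i \<and> LR_min p j} else [1])
    [0..<length p]"
  define w where "w = inflate p ss"
  have one: "[1] \<in> ?C" using singleton_in_Av_123 Av_123_subset by blast
  have ss: "ss ! i \<in> ?C" if "i < length p" for i
    using that one ts card_LR_min_before_less[of p i] by (auto simp: ss_def subset_iff)
  have perms: "is_perm p" "length ss = length p" "\<forall>s \<in> set ss. is_perm s"
  proof -
    show "is_perm p" using p by (simp add: Av_def)
    show len: "length ss = length p" by (simp add: ss_def)
    show "\<forall>s \<in> set ss. is_perm s"
      using ss len by (auto simp: in_set_conv_nth Av_def)
  qed
  obtain A B where
    AB: "\<And>i. i < length w \<Longrightarrow> A i < length p \<and> B i < length (ss ! A i)"
    and mono: "\<And>i j. i < j \<Longrightarrow> j < length w \<Longrightarrow> A i < A j \<or> A i = A j \<and> B i < B j"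
    and out: "\<And>i j. i < length w \<Longrightarrow> j < length w \<Longrightarrow> A i \<noteq> A j \<Longrightarrow>
       w ! i < w ! j \<longleftrightarrow> p ! A i < p ! A j"
    and inn: "\<And>i j. i < length w \<Longrightarrow> j < length w \<Longrightarrow> A i = A j \<Longrightarrow>
       w ! i < w ! j \<longleftrightarrow> ss ! A i ! B i < ss ! A j ! B j"
    by (rule inflate_coordinates[OF perms, folded w_def]) (rule that, blast+)
  \<comment> \<open>Only LR-minima are inflated by more than one entry.\<close>
  have LR: "LR_min p (A j)" if "i < j" "j < length w" "A i = A j" for i j
  proof (rule ccontr)
    assume "\<not> LR_min p (A j)"
    then have "length (ss ! A j) = 1" using AB[of j] that by (simp add: ss_def)
    then show False using mono[OF that(1,2)] AB[of j] that by simp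
  qed
  have first: "A i = A j"
    if "i < j" "j < k" "k < length w" "w ! i < w ! k" "A j = A k" for i j k
  proof (rule ccontr)
    assume ne: "A i \<noteq> A j"
    then have "A i < A k" using mono[of i j] that by auto
    then have "p ! A k < p ! A i" using LR[of j k] that by (auto simp: LR_min_def)
    moreover have "p ! A i < p ! A k" using out[of i k] that ne by auto
    ultimately show False by simp
  qed
  have between: "A y = A x"
    if "x < length w" "y < length w" "z < length w" "w ! x < w ! y" "w ! y < w ! z" "A x = A z"
    for x y z
    using that out[of x y] out[of y z] by (metis less_asym)
  have "\<not> bad_quadruple w i j k l" for i j k l
  proof
    assume b: "bad_quadruple w i j k l"
    then have ord: "i < j" "j < k" "k < l" and bd: "i < length w" "j < length w" "k < length w"
      "l < length w" and lw: "w ! i < w ! j" "w ! i < w ! k" "w ! i < w ! l"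
      by (auto simp: bad_quadruple_def)
    have le: "A i \<le> A j" "A j \<le> A k" "A k \<le> A l"
      using mono[OF ord(1)] mono[OF ord(2)] mono[OF ord(3)] bd by force+
    consider (same) "A i = A j" | (late) "A i \<noteq> A j" "A j = A k \<or> A k = A l"
      | (distinct) "A i < A j" "A j < A k" "A k < A l"
      using le by linarith
    then show False
    proof cases
      case same
      \<comment> \<open>The value at \<open>l\<close> lies between those at \<open>i\<close> and \<open>j\<close> in both patterns; \<open>k\<close> then follows,
        being between \<open>j\<close> and \<open>l\<close> in position.\<close>
      have l: "A l = A i"
        using b same between[of i l j] bd by (auto simp: bad_quadruple_def)
      then have eq: "A j = A i" "A k = A i" using le by auto
      have "bad_quadruple (ss ! A i) (B i) (B j) (B k) (B l)"
        using b l eq AB[OF bd(4)] mono[OF ord(1)] mono[OF ord(2)] mono[OF ord(3)] bd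
          inn[of i k] inn[of k l] inn[of l j] inn[of i l] inn[of j k]
        by (auto simp: bad_quadruple_def)
      then show False using ss AB[OF bd(1)] Av_1423_1342_iff by blast
    next
      case late
      then show False using first[of i j k] first[of i k l] ord bd lw le by force
    next
      case distinct
      then have "bad_quadruple p (A i) (A j) (A k) (A l)"
        using b AB[OF bd(4)] bd
          out[of i k] out[of k l] out[of l j] out[of i l] out[of j k]
        by (auto simp: bad_quadruple_def)
      then show False using p Av_1423_1342_iff by blast
    qed
  qed
  moreover have "is_perm w" unfolding w_def by (rule is_perm_inflate[OF perms])
  ultimately have "w \<in> ?C" using Av_1423_1342_iff by blast
  then show "LR_inflate p ts \<in> ?C" by (simp add: LR_inflate_def w_def ss_def)
qed

section \<open>Standardization\<close>

definition standardize :: "nat list \<Rightarrow> nat list" where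
  "standardize w = map (\<lambda>x. card {y \<in> set w. y \<le> x}) w"

lemma length_standardize [simp]: "length (standardize w) = length w"
  by (simp add: standardize_def)

lemma order_iso_standardize: "order_iso w (standardize w)"
  unfolding order_iso_def
proof (intro conjI allI impI)
  fix i j assume ij: "i < length w" "j < length w"
  let ?D = "\<lambda>x. {y \<in> set w. y \<le> x}"
  have "card (?D (w ! i)) < card (?D (w ! j))" if "w ! i < w ! j"
  proof (rule psubset_card_mono)
    have "w ! j \<in> ?D (w ! j)" "w ! j \<notin> ?D (w ! i)" using that ij by auto
    moreover have "?D (w ! i) \<subseteq> ?D (w ! j)" using that by auto
    ultimately show "?D (w ! i) \<subset> ?D (w ! j)" by blast
  qed simp
  moreover have "card (?D (w ! j)) \<le> card (?D (w ! i))" if "\<not> w ! i < w ! j"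
    using that by (intro card_mono) auto
  ultimately show "w ! i < w ! j \<longleftrightarrow> standardize w ! i < standardize w ! j"
    using ij by (fastforce simp: standardize_def)
qed simp

lemma is_perm_standardize:
  assumes "distinct w" "w \<noteq> []"
  shows "is_perm (standardize w)"
proof -
  have dist: "distinct (standardize w)"
    unfolding distinct_conv_nth length_standardize
  proof (intro allI impI)
    fix i j assume "i < length w" "j < length w" "i \<noteq> j"
    moreover from this have "w ! i \<noteq> w ! j" using assms(1) by (simp add: nth_eq_iff_index_eq)
    ultimately show "standardize w ! i \<noteq> standardize w ! j"
      using order_iso_standardize[of w] unfolding order_iso_def by (metis linorder_neqE_nat less_irrefl)
  qed
  have "card {y \<in> set w. y \<le> x} \<in> {1..length w}" if "x \<in> set w" for x
  proof -
    have "card {y \<in> set w. y \<le> x} \<le> card (set w)" by (intro card_mono) auto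
    moreover have "0 < card {y \<in> set w. y \<le> x}" using that by (auto simp: card_gt_0_iff)
    ultimately show ?thesis using card_length[of w] by simp
  qed
  then have "set (standardize w) \<subseteq> {1..length w}"
    by (auto simp: standardize_def)
  then have "set (standardize w) = {1..length w}"
    by (rule card_subset_eq[rotated]) (simp_all add: distinct_card[OF dist])
  then show ?thesis using dist assms(2) by (simp add: is_perm_def standardize_def)
qed

lemma contains_standardize: "subseq w p \<Longrightarrow> contains p (standardize w)"
  using order_iso_standardize by (auto simp: contains_def)

section \<open>Contracting an interval with a left-to-right minimum\<close>

text \<open>
  The factor \<open>ys\<close> is an interval of the permutation. Requiring all of \<open>xs\<close> to lie above it is what
  makes the contracted entry an LR-minimum, so that inflating this entry alone restores the
  permutation.
\<close>

lemma LR_inflate_contraction: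
  assumes p: "is_perm (xs @ ys @ zs)" and ne: "ys \<noteq> []"
    and xs: "\<forall>v \<in> set xs. \<forall>y \<in> set ys. y < v"
    and zs: "\<forall>v \<in> set zs. (\<forall>y \<in> set ys. v < y) \<or> (\<forall>y \<in> set ys. y < v)"
  defines "q \<equiv> standardize (xs @ hd ys # zs)"
  obtains ts where "length ts = num_LR_min q" "set ts \<subseteq> {[1], standardize ys}"
    "LR_inflate q ts = xs @ ys @ zs"
proof -
  let ?n = "length xs"
  let ?w = "xs @ hd ys # zs"
  let ?bs = "map (\<lambda>x. [x]) xs @ ys # map (\<lambda>x. [x]) zs"
  have hd: "hd ys \<in> set ys" using ne by simp
  have dist: "distinct ?w" "distinct ys" using p hd by (auto simp: is_perm_def)
  have perm_q: "is_perm q" unfolding q_def using dist(1) by (intro is_perm_standardize) auto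
  have perm_ys: "is_perm (standardize ys)" using dist(2) ne by (intro is_perm_standardize)
  have len: "length q = length ?w" by (simp add: q_def)
  have q: "q ! i < q ! j \<longleftrightarrow> ?w ! i < ?w ! j" if "i < length q" "j < length q" for i j
    using order_iso_standardize[of ?w] that by (simp add: q_def order_iso_def)
  have LR: "LR_min q ?n"
    unfolding LR_min_def
  proof (intro conjI allI impI)
    show n: "?n < length q" by (simp add: len)
    fix j assume j: "j < ?n"
    then have "?w ! ?n < ?w ! j" using xs hd by (simp add: nth_append)
    then show "q ! ?n < q ! j" using q[of ?n j] n j by simp
  qed
  let ?rank = "\<lambda>i. card {j. j < i \<and> LR_min q j}"
  have rank_mono: "?rank i < ?rank j" if "LR_min q i" "i < j" for i j
    using that by (intro psubset_card_mono) auto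
  \<comment> \<open>All LR-minima are inflated trivially except the contracted one, which is addressed by its rank
    among the LR-minima.\<close>
  define ts where "ts = (replicate (num_LR_min q) [1])[?rank ?n := standardize ys]"
  define ss where "ss = map (\<lambda>i. if LR_min q i then ts ! ?rank i else [1]) [0..<length q]"
  have ss_nth: "ss ! i = (if i = ?n then standardize ys else [1])" if "i < length q" for i
  proof (cases "LR_min q i")
    case True
    then have "?rank i = ?rank ?n \<longleftrightarrow> i = ?n"
      using rank_mono[of i ?n] rank_mono[of ?n i] LR by (metis less_irrefl linorder_neqE_nat)
    then show ?thesis
      using True that LR card_LR_min_before_less[of q i]
      by (auto simp: ss_def ts_def nth_list_update)
  next
    case False
    then show ?thesis using that LR by (auto simp: ss_def)
  qed
  have lss: "length ss = length q" by (simp add: ss_def)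
  have "is_perm [1]" by (simp add: is_perm_def)
  then have perms: "\<forall>s \<in> set ss. is_perm s"
    using ss_nth perm_ys lss by (auto simp: in_set_conv_nth)
  have bs_eq: "?bs ! i = [?w ! i]" if "i < length q" "i \<noteq> ?n" for i
    using that by (auto simp: len nth_append nth_Cons split: nat.split)
  have concat: "concat ?bs = xs @ ys @ zs" by (simp add: concat_map_singleton)
  have "concat ?bs = inflate q ss"
  proof (rule inflate_unique[OF perm_q lss perms])
    show "is_perm (concat ?bs)" using p by (simp only: concat)
    show "length ?bs = length q" by (simp add: len)
    show "\<forall>i < length q. order_iso (?bs ! i) (ss ! i)"
    proof (intro allI impI)
      fix i assume i: "i < length q"
      show "order_iso (?bs ! i) (ss ! i)"
      proof (cases "i = ?n")
        case True
        then show ?thesis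
          using ss_nth[OF i] order_iso_standardize[of ys] by (simp add: nth_append)
      next
        case False
        then show ?thesis using ss_nth[OF i] bs_eq[OF i] by (simp add: order_iso_def)
      qed
    qed
    show "\<forall>i < length q. \<forall>j < length q. q ! i < q ! j \<longrightarrow>
      (\<forall>x \<in> set (?bs ! i). \<forall>y \<in> set (?bs ! j). x < y)"
    proof (intro allI impI)
      fix i j assume i: "i < length q" and j: "j < length q" and "q ! i < q ! j"
      then have less: "?w ! i < ?w ! j" using q by blast
      have wn: "?w ! ?n = hd ys" "?bs ! ?n = ys" by (auto simp: nth_append)
      have outside: "(\<forall>y \<in> set ys. ?w ! k < y) \<or> (\<forall>y \<in> set ys. y < ?w ! k)"
        if "k < length q" "k \<noteq> ?n" for k
      proof -
        have "?w ! k \<in> set xs \<union> set zs"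
          using that by (auto simp: len nth_append nth_Cons split: nat.split)
        then show ?thesis using xs zs by blast
      qed
      consider "i = ?n" "j \<noteq> ?n" | "i \<noteq> ?n" "j = ?n" | "i \<noteq> ?n" "j \<noteq> ?n"
        using less by (cases "i = ?n"; cases "j = ?n") auto
      then show "\<forall>x \<in> set (?bs ! i). \<forall>y \<in> set (?bs ! j). x < y"
      proof cases
        case 1
        then show ?thesis using outside[OF j] less wn hd bs_eq[OF j] by (auto dest: less_asym)
      next
        case 2
        then show ?thesis using outside[OF i] less wn hd bs_eq[OF i] by (auto dest: less_asym)
      next
        case 3
        then show ?thesis using less bs_eq[OF i] bs_eq[OF j] by simp
      qed
    qed
  qed
  then have "LR_inflate q ts = xs @ ys @ zs"
    by (simp add: LR_inflate_def ss_def concat del: concat_append)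
  moreover have "length ts = num_LR_min q" by (simp add: ts_def)
  moreover have "set ts \<subseteq> {[1], standardize ys}"
    using set_update_subset_insert[of "replicate (num_LR_min q) [1]" "?rank ?n" "standardize ys"]
    by (auto simp: ts_def)
  ultimately show thesis using that by blast
qed

section \<open>Intervals from connected components of increasing pairs\<close>

definition incr_pair :: "nat list \<Rightarrow> nat \<Rightarrow> nat \<Rightarrow> bool" where
  "incr_pair p x y \<longleftrightarrow> x < y \<and> p ! x < p ! y"

text \<open>
  The connected component of position \<open>a\<close> in the graph on the positions to the left of and below
  \<open>c\<close> whose edges are the increasing pairs; it is empty if \<open>a\<close> is not a vertex.
\<close>

inductive_set component :: "nat list \<Rightarrow> nat \<Rightarrow> nat \<Rightarrow> nat set" for p c a where
  base: "incr_pair p a c \<Longrightarrow> a \<in> component p c a"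
| step: "x \<in> component p c a \<Longrightarrow> incr_pair p y c \<Longrightarrow> incr_pair p x y \<or> incr_pair p y x \<Longrightarrow>
    y \<in> component p c a"

lemma component_below_left: "x \<in> component p c a \<Longrightarrow> incr_pair p x c"
  by (induction rule: component.induct) auto

text \<open>
  Connectedness in the form used later: any property that splits the component is also split by
  one of its edges.
\<close>

lemma component_crossing_pair:
  assumes "x \<in> component p c a" "y \<in> component p c a" "P x" "\<not> P y"
  obtains u v where "u \<in> component p c a" "v \<in> component p c a" "P u" "\<not> P v"
    "incr_pair p u v \<or> incr_pair p v u"
proof -
  have "P z = P a \<or> (\<exists>u \<in> component p c a. \<exists>v \<in> component p c a. P u \<and> \<not> P v \<and>
      (incr_pair p u v \<or> incr_pair p v u))" if "z \<in> component p c a" for z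
    using that
  proof (induction rule: component.induct)
    case (step u v)
    then have "v \<in> component p c a" by (blast intro: component.step)
    with step show ?case by metis
  qed simp
  from this[OF assms(1)] this[OF assms(2)] show thesis using that assms(3,4) by blast
qed

text \<open>
  An edge \<open>u < v\<close> crossing \<open>e\<close> together with \<open>c\<close> leaves two possibilities. If \<open>e\<close> is not below and
  to the left of \<open>c\<close>, then \<open>u\<close>, \<open>v\<close>, \<open>e\<close>, \<open>c\<close> form 1423 (separation in position) or 1342
  (separation in value). Otherwise \<open>e\<close> is a vertex, and being between \<open>u\<close> and \<open>v\<close> in one coordinate
  it is joined to one of them whatever its other coordinate.
\<close>

lemma component_interval:
  assumes p: "is_perm p" "\<And>i j k l. \<not> bad_quadruple p i j k l"
    and c: "c < length p" and e: "e < length p" "e \<notin> component p c a"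
    and x: "x \<in> component p c a" and y: "y \<in> component p c a"
  shows "\<not> (x < e \<and> e < y)" and "\<not> (p ! x < p ! e \<and> p ! e < p ! y)"
proof -
  let ?I = "component p c a"
  have neq: "p ! u \<noteq> p ! v" if "u < length p" "v < length p" "u \<noteq> v" for u v
    using p(1) that by (simp add: is_perm_def nth_eq_iff_index_eq)
  have I: "u < c" "u < length p" "p ! u < p ! c" "u \<noteq> e" if "u \<in> ?I" for u
    using component_below_left[OF that] that c e(2) by (auto simp: incr_pair_def)
  show "\<not> (x < e \<and> e < y)"
  proof
    assume xey: "x < e \<and> e < y"
    obtain u v where uv: "u \<in> ?I" "v \<in> ?I" "u < e" "\<not> v < e" "incr_pair p u v \<or> incr_pair p v u"
      using component_crossing_pair[OF x y, of "\<lambda>z. z < e"] xey by auto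
    then have o: "u < e" "e < v" "p ! u < p ! v" using I(4)[of v] by (auto simp: incr_pair_def)
    have "\<not> p ! c < p ! e"
    proof
      assume "p ! c < p ! e"
      then have "bad_quadruple p u e v c"
        using o I[OF uv(2)] c by (auto simp: bad_quadruple_def)
      then show False using p(2) by blast
    qed
    then have "incr_pair p e c"
      using neq[of e c] e c o I(1)[OF uv(2)] by (auto simp: incr_pair_def)
    moreover have "incr_pair p u e \<or> incr_pair p e v"
      using o by (auto simp: incr_pair_def)
    ultimately have "e \<in> ?I" using uv(1,2) by (blast intro: component.step)
    then show False using e by simp
  qed
  show "\<not> (p ! x < p ! e \<and> p ! e < p ! y)"
  proof
    assume xey: "p ! x < p ! e \<and> p ! e < p ! y"
    obtain u v where uv: "u \<in> ?I" "v \<in> ?I" "p ! u < p ! e" "\<not> p ! v < p ! e"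
      "incr_pair p u v \<or> incr_pair p v u"
      using component_crossing_pair[OF x y, of "\<lambda>z. p ! z < p ! e"] xey by auto
    then have o: "p ! u < p ! e" "p ! e < p ! v" "u < v"
      using neq[of e v] e I(2,4)[of v] by (auto simp: incr_pair_def)
    have ec: "e \<noteq> c" using o I(3)[OF uv(2)] by auto
    have "\<not> c < e"
    proof
      assume "c < e"
      then have "bad_quadruple p u v c e"
        using o I[OF uv(2)] e by (auto simp: bad_quadruple_def)
      then show False using p(2) by blast
    qed
    then have "incr_pair p e c"
      using ec o I(3)[OF uv(2)] by (auto simp: incr_pair_def)
    moreover have "incr_pair p u e \<or> incr_pair p e v"
      using o I(4)[OF uv(2)] uv(1) by (auto simp: incr_pair_def)
    ultimately have "e \<in> ?I" using uv(1,2) by (blast intro: component.step)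
    then show False using e by simp
  qed
qed

text \<open>
  The interval is the component of \<open>a\<close> below and to the left of \<open>c\<close>, for an occurrence
  \<open>a\<close>, \<open>b\<close>, \<open>c\<close> of 123. Entries preceding the interval are above \<open>a\<close>, since \<open>a\<close> is chosen to be an
  LR-minimum, and hence above the whole interval.
\<close>

lemma obtain_interval:
  assumes p: "is_perm p" "\<And>i j k l. \<not> bad_quadruple p i j k l" and "contains p [1,2,3]"
  obtains xs ys zs where "p = xs @ ys @ zs" "2 \<le> length ys" "length ys < length p"
    "\<forall>v \<in> set xs. \<forall>y \<in> set ys. y < v"
    "\<forall>v \<in> set zs. (\<forall>y \<in> set ys. v < y) \<or> (\<forall>y \<in> set ys. y < v)"
proof -
  obtain a' b c where abc: "a' < b" "b < c" "c < length p" "p ! a' < p ! b" "p ! b < p ! c"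
    using assms(3) contains_123_iff by blast
  \<comment> \<open>Replacing \<open>a'\<close> by the smallest entry up to it makes the first entry an LR-minimum.\<close>
  obtain a where a: "a \<le> a'" "\<And>z. z \<le> a' \<Longrightarrow> p ! a \<le> p ! z"
    using arg_min_if_finite[of "{..a'}" "(!) p"] by (metis arg_min_least atMost_iff atMost_subset_iff
        empty_iff finite_atMost order_refl)
  have neq: "p ! u \<noteq> p ! v" if "u < length p" "v < length p" "u \<noteq> v" for u v
    using p(1) that by (simp add: is_perm_def nth_eq_iff_index_eq)
  have ab: "a < b" "p ! a < p ! b" using a(1) a(2)[of a'] abc by auto
  let ?I = "component p c a"
  have aI: "a \<in> ?I" using ab abc by (intro component.base) (simp add: incr_pair_def)
  have bI: "b \<in> ?I" using ab abc
    by (intro component.step[OF aI]) (simp_all add: incr_pair_def)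
  have Ic: "?I \<subseteq> {..<c}" using component_below_left by (auto simp: incr_pair_def)
  then have fin: "finite ?I" by (rule finite_subset) simp
  define s t where "s = Min ?I" and "t = Max ?I"
  have st: "s \<in> ?I" "t \<in> ?I" "\<And>x. x \<in> ?I \<Longrightarrow> s \<le> x \<and> x \<le> t"
    using fin aI Min_in[OF fin] Max_in[OF fin] unfolding s_def t_def by fastforce+
  have tc: "t < c" using st(2) Ic by auto
  have I: "?I = {s..t}"
  proof (rule subset_antisym)
    show "{s..t} \<subseteq> ?I"
    proof
      fix e assume e: "e \<in> {s..t}"
      show "e \<in> ?I"
      proof (rule ccontr)
        assume n: "e \<notin> ?I"
        then have "e \<noteq> s" "e \<noteq> t" using st by auto
        then show False
          using component_interval(1)[OF p abc(3) _ n st(1,2)] e tc abc(3) by auto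
      qed
    qed
  qed (use st(3) in auto)
  define xs ys zs where "xs = take s p" and "ys = take (Suc t - s) (drop s p)"
    and "zs = drop (Suc t) p"
  have s: "s \<le> t" using st by auto
  have "drop (Suc t - s) (drop s p) = zs" using s by (simp add: zs_def)
  then have dec: "p = xs @ ys @ zs" by (metis append_take_drop_id xs_def ys_def)
  have ys: "set ys \<subseteq> (!) p ` ?I"
  proof
    fix y assume "y \<in> set ys"
    then obtain i where "i < length ys" "ys ! i = y" by (auto simp: in_set_conv_nth)
    then show "y \<in> (!) p ` ?I"
      using s by (auto simp: I ys_def intro!: image_eqI[of _ _ "s + i"])
  qed
  have sep: "(\<forall>z \<in> ?I. p ! e < p ! z) \<or> (\<forall>z \<in> ?I. p ! z < p ! e)"
    if e: "e < length p" "e \<notin> ?I" for e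
  proof (rule ccontr)
    assume "\<not> ?thesis"
    then obtain x y where xy: "x \<in> ?I" "y \<in> ?I" "\<not> p ! e < p ! x" "\<not> p ! y < p ! e" by blast
    have "x < c" "y < c" using xy(1,2) Ic by auto
    then have "p ! x \<noteq> p ! e" "p ! y \<noteq> p ! e"
      using neq[of x e] neq[of y e] xy(1,2) e abc(3) by auto
    then show False
      using component_interval(2)[OF p abc(3) e xy(1,2)] xy(3,4) by simp
  qed
  show thesis
  proof (rule that[OF dec])
    have "s \<le> a" "b \<le> t" using aI bI st by auto
    then show "2 \<le> length ys" using ab tc abc(3) by (simp add: ys_def)
    show "length ys < length p" using tc abc(3) s by (simp add: ys_def)
    show "\<forall>v \<in> set xs. \<forall>y \<in> set ys. y < v"
    proof (intro ballI)
      fix v y assume v: "v \<in> set xs" and y: "y \<in> set ys"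
      obtain e where e: "e < s" "v = p ! e" "e < length p"
        using v by (auto simp: xs_def in_set_conv_nth)
      have "p ! a \<le> p ! e" using a(1) a(2)[of e] e \<open>s \<le> a\<close> by simp
      then have "\<forall>z \<in> ?I. p ! z < p ! e" using sep[of e] e aI I by fastforce
      then show "y < v" using y ys e by auto
    qed
    show "\<forall>v \<in> set zs. (\<forall>y \<in> set ys. v < y) \<or> (\<forall>y \<in> set ys. y < v)"
    proof
      fix v assume "v \<in> set zs"
      then obtain i where i: "i < length zs" "v = zs ! i" by (metis in_set_conv_nth)
      define e where "e = Suc t + i"
      have "t < e" "v = p ! e" "e < length p" using i by (auto simp: e_def zs_def)
      then show "(\<forall>y \<in> set ys. v < y) \<or> (\<forall>y \<in> set ys. y < v)"
        using sep[of e] ys I by fastforce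
    qed
  qed
qed

section \<open>Decomposition by repeated contraction\<close>

lemma Av_subset_LR_closed:
  assumes D: "Av {[1,2,3]} \<subseteq> D" "LR_closed D"
  shows "Av {[1,4,2,3], [1,3,4,2]} \<subseteq> D"
proof
  fix p assume "p \<in> Av {[1,4,2,3], [1,3,4,2]}"
  then show "p \<in> D"
  proof (induction "length p" arbitrary: p rule: less_induct)
    case less
    let ?C = "Av {[1,4,2,3], [1,3,4,2]}"
    have p: "is_perm p" "\<And>i j k l. \<not> bad_quadruple p i j k l"
      using less.prems Av_1423_1342_iff by auto
    show ?case
    proof (cases "contains p [1,2,3]")
      case False
      then show ?thesis using p D by (auto simp: Av_def)
    next
      case True
      obtain xs ys zs where d: "p = xs @ ys @ zs" "2 \<le> length ys" "length ys < length p"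
        "\<forall>v \<in> set xs. \<forall>y \<in> set ys. y < v"
        "\<forall>v \<in> set zs. (\<forall>y \<in> set ys. v < y) \<or> (\<forall>y \<in> set ys. y < v)"
        using obtain_interval[OF p True] by blast
      have ne: "ys \<noteq> []" using d(2) by auto
      have smaller: "standardize w \<in> D" if "subseq w p" "w \<noteq> []" "length w < length p" for w
      proof -
        have "distinct w" using that(1) p(1) by (auto simp: is_perm_def subseq_conv_nths)
        then have "standardize w \<in> ?C"
          using perm_class_Av[of "{[1,4,2,3], [1,3,4,2]}"] less.prems that contains_standardize
            is_perm_standardize unfolding perm_class_def by blast
        then show ?thesis using less.hyps that(3) by simp
      qed
      have "subseq [hd ys] ys" using ne by (simp add: subseq_singleton_left)
      then have "subseq (xs @ hd ys # zs) p"
        unfolding d(1) by (metis append_Cons append_Nil list_emb_append_mono subseq_order.order_refl)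
      then have q: "standardize (xs @ hd ys # zs) \<in> D"
        using d(1,2) by (intro smaller) auto
      have "subseq ys p" unfolding d(1)
        by (meson subseq_drop_many subseq_order.order_refl subseq_rev_drop_many)
      then have r: "standardize ys \<in> D" using ne d(3) by (intro smaller) auto
      obtain ts where ts: "length ts = num_LR_min (standardize (xs @ hd ys # zs))"
        "set ts \<subseteq> {[1], standardize ys}" "LR_inflate (standardize (xs @ hd ys # zs)) ts = p"
        using LR_inflate_contraction[of xs ys zs] p(1) d ne by metis
      have "[1] \<in> D" using D(1) singleton_in_Av_123 by blast
      then have "set ts \<subseteq> D" using ts(2) r by blast
      then have "LR_inflate (standardize (xs @ hd ys # zs)) ts \<in> D"
        using D(2) q ts(1) unfolding LR_closed_def by blast
      then show ?thesis by (simp only: ts(3))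
    qed
  qed
qed

theorem proposition5p1:
  shows "Av {[1,4,2,3], [1,3,4,2]} = LR_closure (Av {[1,2,3]})"
proof
  show "Av {[1,4,2,3], [1,3,4,2]} \<subseteq> LR_closure (Av {[1,2,3]})"
    unfolding LR_closure_def using Av_subset_LR_closed by blast
  show "LR_closure (Av {[1,2,3]}) \<subseteq> Av {[1,4,2,3], [1,3,4,2]}"
    unfolding LR_closure_def using perm_class_Av Av_123_subset LR_closed_Av by blast
qed

end
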